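(* Let $k$ be a field and let $C$ be the coalgebra over $k$ with basis $1,x,y,z,t$ in which $1$ is group-like, $t,y,z$ are primitive and $$\triangle(x)=1\otimes x+x\otimes1+y\otimes z.$$ Then $C$ carries a unique rack bialgebra structure (with coaugmentation $1$) in which the maps $-\lhd x,\ -\lhd t\colon C\to C$ are zero and $$x\lhd z=t,\quad x\lhd y=t,\quad z\lhd z=0,\quad z\lhd y=0,$$ $$y\lhd z=0,\quad y\lhd y=0,\quad t\lhd z=0,\quad t\lhd y=0.$$
   Context: Sweedler notation $\triangle(c)=c_{(1)}\otimes c_{(2)}$ is used. An element $c$ is primitive if $\triangle(c)=1\otimes c+c\otimes1$; the counit satisfies $\epsilon(1)=1$ and $\epsilon(x)=\epsilon(y)=\epsilon(z)=\epsilon(t)=0$. A rack bialgebra is a coassociative counital coalgebra $(C,\triangle,\epsilon)$ with a distinguished group-like element $1\in C$ (the coaugmentation) together with a morphism of coalgebras $\lhd\colon C\otimes C\to C$ such that for all $a,b,c\in C$: $(a\lhd b)\lhd c=(a\lhd c_{(1)})\lhd(b\lhd c_{(2)})$, $a\lhd 1=a$, $1\lhd a=\epsilon(a)1$, $\epsilon(a\lhd b)=\epsilon(a)\epsilon(b)$. *)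

theory Defs
  imports Complex_Main "HOL-Library.Poly_Mapping"
begin

section \<open>Formal linear combinations\<close>

text \<open>The free vector space on a type \<open>'b\<close> over a field \<open>'k\<close> is the type \<open>'b \<Rightarrow>\<^sub>0 'k\<close> of finitely
  supported functions.\<close>

definition formal_scale :: "'k::field \<Rightarrow> ('b \<Rightarrow>\<^sub>0 'k) \<Rightarrow> ('b \<Rightarrow>\<^sub>0 'k)" where
  "formal_scale r f = Poly_Mapping.map ((*) r) f"

lemma lookup_formal_scale: "Poly_Mapping.lookup (formal_scale r f) p = r * Poly_Mapping.lookup f p"
  by (simp add: formal_scale_def Poly_Mapping.map.rep_eq when_def)

global_interpretation formal: vector_space formal_scale
  by unfold_locales
    (auto intro!: poly_mapping_eqI simp: lookup_formal_scale lookup_add algebra_simps)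

text \<open>The linear extension of a map \<open>B\<close> defined on the basis \<open>'b\<close> of the free vector space. Applied
  to \<open>f = \<Sum>\<^sub>i c\<^sub>i (u\<^sub>i, v\<^sub>i)\<close> and \<open>\<lambda>(u, v). B u v\<close> it is the sum \<open>\<Sum>\<^sub>i c\<^sub>i B u\<^sub>i v\<^sub>i\<close> which Sweedler
  notation abbreviates.\<close>

definition lin_ext :: "('k::field \<Rightarrow> 'u::comm_monoid_add \<Rightarrow> 'u) \<Rightarrow> ('b \<Rightarrow> 'u) \<Rightarrow> ('b \<Rightarrow>\<^sub>0 'k) \<Rightarrow> 'u" where
  "lin_ext s B f = (\<Sum>p\<in>Poly_Mapping.keys f. s (Poly_Mapping.lookup f p) (B p))"

section \<open>Tensor squares and cubes of a vector space\<close>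

text \<open>\<open>V \<otimes> V\<close> and \<open>V \<otimes> V \<otimes> V\<close> are quotients of the free vector spaces on \<open>V \<times> V\<close> and
  \<open>V \<times> V \<times> V\<close> by the subspace generated by the multilinearity relations. Their elements are
  represented as cosets. Below, \<open>\<iota>\<close> inserts a vector into one slot of a tuple.\<close>

definition slot_relations :: "('k::field \<Rightarrow> 'v::ab_group_add \<Rightarrow> 'v) \<Rightarrow> ('v \<Rightarrow> 'b) \<Rightarrow> ('b \<Rightarrow>\<^sub>0 'k) set" where
  "slot_relations s \<iota> =
     {Poly_Mapping.single (\<iota> (a + b)) 1 - Poly_Mapping.single (\<iota> a) 1
        - Poly_Mapping.single (\<iota> b) 1 | a b. True}
   \<union> {Poly_Mapping.single (\<iota> (s r a)) 1 - formal_scale r (Poly_Mapping.single (\<iota> a) 1) | r a. True}"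

definition null2 :: "('k::field \<Rightarrow> 'v::ab_group_add \<Rightarrow> 'v) \<Rightarrow> ('v \<times> 'v \<Rightarrow>\<^sub>0 'k) set" where
  "null2 s = formal.span
     ((\<Union>w. slot_relations s (\<lambda>v. (v, w))) \<union> (\<Union>v. slot_relations s (\<lambda>w. (v, w))))"

definition null3 :: "('k::field \<Rightarrow> 'v::ab_group_add \<Rightarrow> 'v) \<Rightarrow> ('v \<times> 'v \<times> 'v \<Rightarrow>\<^sub>0 'k) set" where
  "null3 s = formal.span
     ((\<Union>v w. slot_relations s (\<lambda>u. (u, v, w)))
      \<union> (\<Union>u w. slot_relations s (\<lambda>v. (u, v, w)))
      \<union> (\<Union>u v. slot_relations s (\<lambda>w. (u, v, w))))"

definition tensor2 :: "('k::field \<Rightarrow> 'v::ab_group_add \<Rightarrow> 'v) \<Rightarrow> ('v \<times> 'v \<Rightarrow>\<^sub>0 'k) \<Rightarrow> ('v \<times> 'v \<Rightarrow>\<^sub>0 'k) set" where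
  "tensor2 s f = {g. g - f \<in> null2 s}"

definition tensor3 ::
  "('k::field \<Rightarrow> 'v::ab_group_add \<Rightarrow> 'v) \<Rightarrow> ('v \<times> 'v \<times> 'v \<Rightarrow>\<^sub>0 'k) \<Rightarrow> ('v \<times> 'v \<times> 'v \<Rightarrow>\<^sub>0 'k) set" where
  "tensor3 s f = {g. g - f \<in> null3 s}"

abbreviation pure2 :: "'v \<Rightarrow> 'v \<Rightarrow> ('v \<times> 'v \<Rightarrow>\<^sub>0 'k::field)" where
  "pure2 u v \<equiv> Poly_Mapping.single (u, v) 1"

abbreviation pure3 :: "'v \<Rightarrow> 'v \<Rightarrow> 'v \<Rightarrow> ('v \<times> 'v \<times> 'v \<Rightarrow>\<^sub>0 'k::field)" where
  "pure3 u v w \<equiv> Poly_Mapping.single (u, v, w) 1"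

section \<open>Coalgebras and rack bialgebras\<close>

text \<open>A vector space \<open>C\<close> with linear maps \<open>\<Delta> : C \<rightarrow> C \<otimes> C\<close> and \<open>\<epsilon> : C \<rightarrow> k\<close>, subject to no further
  axioms. As \<open>\<Delta> c\<close> is a coset, \<open>f \<in> \<Delta> c\<close> says that the formal sum \<open>f\<close> represents \<open>\<Delta> c\<close>.\<close>

locale pre_coalgebra = vector_space scale
  for scale :: "'k::field \<Rightarrow> 'v::ab_group_add \<Rightarrow> 'v" +
  fixes \<Delta> :: "'v \<Rightarrow> ('v \<times> 'v \<Rightarrow>\<^sub>0 'k) set"
    and \<epsilon> :: "'v \<Rightarrow> 'k"
  assumes comult_in_tensor: "\<Delta> c \<in> range (tensor2 scale)"
    and comult_add: "f \<in> \<Delta> a \<Longrightarrow> g \<in> \<Delta> b \<Longrightarrow> \<Delta> (a + b) = tensor2 scale (f + g)"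
    and comult_scale: "f \<in> \<Delta> a \<Longrightarrow> \<Delta> (scale r a) = tensor2 scale (formal_scale r f)"
    and counit_linear: "Vector_Spaces.linear scale (*) \<epsilon>"

text \<open>In \<open>coassoc\<close>, \<open>d\<close> picks a representative of each \<open>\<Delta> a\<close>, so that the two sides are
  \<open>(\<Delta> \<otimes> id) (\<Delta> c)\<close> and \<open>(id \<otimes> \<Delta>) (\<Delta> c)\<close>.\<close>

locale coalgebra = pre_coalgebra scale \<Delta> \<epsilon>
  for scale :: "'k::field \<Rightarrow> 'v::ab_group_add \<Rightarrow> 'v" and \<Delta> \<epsilon> +
  assumes coassoc:
    "f \<in> \<Delta> c \<Longrightarrow> (\<And>a. d a \<in> \<Delta> a) \<Longrightarrow>
       tensor3 scale (lin_ext formal_scale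
         (\<lambda>(c1, c2). lin_ext formal_scale (\<lambda>(p, q). pure3 p q c2) (d c1)) f)
     = tensor3 scale (lin_ext formal_scale
         (\<lambda>(c1, c2). lin_ext formal_scale (\<lambda>(p, q). pure3 c1 p q) (d c2)) f)"
    and counit_left: "f \<in> \<Delta> c \<Longrightarrow> lin_ext scale (\<lambda>(c1, c2). scale (\<epsilon> c1) c2) f = c"
    and counit_right: "f \<in> \<Delta> c \<Longrightarrow> lin_ext scale (\<lambda>(c1, c2). scale (\<epsilon> c2) c1) f = c"

definition group_like ::
  "('k::field \<Rightarrow> 'v::ab_group_add \<Rightarrow> 'v) \<Rightarrow> ('v \<Rightarrow> ('v \<times> 'v \<Rightarrow>\<^sub>0 'k) set) \<Rightarrow> ('v \<Rightarrow> 'k) \<Rightarrow> 'v \<Rightarrow> bool" where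
  "group_like s \<Delta> \<epsilon> g \<longleftrightarrow> \<Delta> g = tensor2 s (pure2 g g) \<and> \<epsilon> g = 1"

definition primitive ::
  "('k::field \<Rightarrow> 'v::ab_group_add \<Rightarrow> 'v) \<Rightarrow> ('v \<Rightarrow> ('v \<times> 'v \<Rightarrow>\<^sub>0 'k) set) \<Rightarrow> 'v \<Rightarrow> 'v \<Rightarrow> bool" where
  "primitive s \<Delta> e c \<longleftrightarrow> \<Delta> c = tensor2 s (pure2 e c + pure2 c e)"

text \<open>The coaugmentation is written \<open>e\<close>. The rack product is given as a bilinear operation, that is,
  as a linear map \<open>C \<otimes> C \<rightarrow> C\<close>; that it is a morphism of coalgebras means
  \<open>\<Delta> (a \<lhd> b) = (a\<^sub>1 \<lhd> b\<^sub>1) \<otimes> (a\<^sub>2 \<lhd> b\<^sub>2)\<close> in Sweedler notation together with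
  \<open>\<epsilon> (a \<lhd> b) = \<epsilon> a * \<epsilon> b\<close>.\<close>

locale rack_bialgebra = coalgebra scale \<Delta> \<epsilon>
  for scale :: "'k::field \<Rightarrow> 'v::ab_group_add \<Rightarrow> 'v" and \<Delta> \<epsilon> +
  fixes e :: 'v
    and rack :: "'v \<Rightarrow> 'v \<Rightarrow> 'v"  (infixl \<open>\<lhd>\<close> 70)
  assumes coaugmentation: "group_like scale \<Delta> \<epsilon> e"
    and rack_linear_left: "Vector_Spaces.linear scale scale (\<lambda>a. a \<lhd> b)"
    and rack_linear_right: "Vector_Spaces.linear scale scale (\<lambda>b. a \<lhd> b)"
    and rack_comult: "f \<in> \<Delta> a \<Longrightarrow> g \<in> \<Delta> b \<Longrightarrow>
      \<Delta> (a \<lhd> b) = tensor2 scale (lin_ext formal_scale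
        (\<lambda>(a1, a2). lin_ext formal_scale (\<lambda>(b1, b2). pure2 (a1 \<lhd> b1) (a2 \<lhd> b2)) g) f)"
    and rack_counit: "\<epsilon> (a \<lhd> b) = \<epsilon> a * \<epsilon> b"
    and self_distrib: "f \<in> \<Delta> c \<Longrightarrow>
      (a \<lhd> b) \<lhd> c = lin_ext scale (\<lambda>(c1, c2). (a \<lhd> c1) \<lhd> (b \<lhd> c2)) f"
    and rack_unit_right: "a \<lhd> e = a"
    and rack_unit_left: "e \<lhd> a = scale (\<epsilon> a) e"

end

theory Submission
  imports Defs
begin

text \<open>In coordinates the structure is \<open>a \<lhd> b = \<epsilon>(b) a + \<lambda>(b) \<phi>(a) t\<close>, where \<open>\<phi>\<close> is the \<open>x\<close>-coordinate
  and \<open>\<lambda>\<close> the sum of the \<open>y\<close>- and \<open>z\<close>-coordinates. Uniqueness holds because the prescribed values and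
  the unit axioms fix a bilinear map on all pairs of basis vectors. For existence, the comultiplication
  has a linear section \<open>D\<close>, given on the basis by the displayed representatives; since the maps
  occurring in the axioms are multilinear, arbitrary representatives can be replaced by \<open>D\<close>, after
  which each axiom is an identity between linear maps that is checked on the basis.\<close>

section \<open>Linear extensions and multilinearity modulo a subspace\<close>

context vector_space
begin

text \<open>Cancellation can make the support of a sum smaller than the union of the supports.
  Summing over a common larger finite set avoids this, since the extra terms have coefficient
  zero.\<close>

lemma lin_ext_superset:
  assumes "finite A" "Poly_Mapping.keys f \<subseteq> A"
  shows "lin_ext scale B f = (\<Sum>p\<in>A. scale (Poly_Mapping.lookup f p) (B p))"
  unfolding lin_ext_def using assms
  by (intro sum.mono_neutral_left) (auto simp: in_keys_iff)

lemma lin_ext_single [simp]: "lin_ext scale B (Poly_Mapping.single p c) = scale c (B p)"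
  by (subst lin_ext_superset[of "{p}"]) auto

lemma lin_ext_add [simp]: "lin_ext scale B (f + g) = lin_ext scale B f + lin_ext scale B g"
proof -
  let ?A = "Poly_Mapping.keys f \<union> Poly_Mapping.keys g"
  have "lin_ext scale B h = (\<Sum>p\<in>?A. scale (Poly_Mapping.lookup h p) (B p))"
    if "h \<in> {f, g, f + g}" for h
    using that Poly_Mapping.keys_add[of f g] by (intro lin_ext_superset) auto
  then show ?thesis
    by (simp add: lookup_add scale_left_distrib sum.distrib)
qed

lemma lin_ext_scale [simp]: "lin_ext scale B (formal_scale r f) = scale r (lin_ext scale B f)"
proof -
  have "Poly_Mapping.keys (formal_scale r f) \<subseteq> Poly_Mapping.keys f"
    by (auto simp: in_keys_iff lookup_formal_scale)
  then have "lin_ext scale B (formal_scale r f)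
      = (\<Sum>p\<in>Poly_Mapping.keys f. scale (Poly_Mapping.lookup (formal_scale r f) p) (B p))"
    by (intro lin_ext_superset) auto
  then show ?thesis
    by (simp add: lin_ext_def lookup_formal_scale scale_sum_right)
qed

lemma linear_lin_ext: "Vector_Spaces.linear formal_scale scale (lin_ext scale B)"
  by (intro_locales; unfold_locales) auto

lemma lin_ext_diff [simp]: "lin_ext scale B (f - g) = lin_ext scale B f - lin_ext scale B g"
  by (metis add_diff_cancel_right' diff_add_cancel lin_ext_add)

lemma lin_ext_fun_add:
  "lin_ext scale (\<lambda>p. B p + B' p) f = lin_ext scale B f + lin_ext scale B' f"
  by (simp add: lin_ext_def scale_right_distrib sum.distrib)

lemma lin_ext_fun_diff:
  "lin_ext scale (\<lambda>p. B p - B' p) f = lin_ext scale B f - lin_ext scale B' f"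
  by (simp add: lin_ext_def scale_right_diff_distrib sum_subtractf)

lemma lin_ext_fun_scale: "lin_ext scale (\<lambda>p. scale r (B p)) f = scale r (lin_ext scale B f)"
  by (simp add: lin_ext_def scale_sum_right mult.commute)

lemma lin_ext_mem:
  assumes "subspace N" "\<And>p. B p \<in> N"
  shows "lin_ext scale B f \<in> N"
  unfolding lin_ext_def using assms by (intro subspace_sum subspace_scale)

lemma lin_ext_cong_mod:
  assumes "subspace N" "\<And>p. B p - B' p \<in> N"
  shows "lin_ext scale B f - lin_ext scale B' f \<in> N"
  using lin_ext_mem[OF assms(1), of "\<lambda>p. B p - B' p"] assms(2)
  by (simp add: lin_ext_fun_diff)

lemma subspace_diff_trans:
  assumes "subspace N" "a - b \<in> N" "b - c \<in> N"
  shows "a - c \<in> N"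
  using subspace_add[OF assms] by simp

end

text \<open>Tensors are handled through representing formal sums, on which maps such as
  \<open>pure2\<close> are additive and homogeneous only up to \<open>null2\<close> or
  \<open>null3\<close>. The choice \<open>N = {0}\<close> gives ordinary bilinearity.\<close>

definition bilinear_mod ::
  "('k::field \<Rightarrow> 'v::ab_group_add \<Rightarrow> 'v) \<Rightarrow> ('k \<Rightarrow> 'u::ab_group_add \<Rightarrow> 'u) \<Rightarrow> 'u set
    \<Rightarrow> ('v \<Rightarrow> 'v \<Rightarrow> 'u) \<Rightarrow> bool" where
  "bilinear_mod s s' N B \<longleftrightarrow>
     (\<forall>a b w. B (a + b) w - B a w - B b w \<in> N) \<and> (\<forall>r a w. B (s r a) w - s' r (B a w) \<in> N)
   \<and> (\<forall>a b w. B w (a + b) - B w a - B w b \<in> N) \<and> (\<forall>r a w. B w (s r a) - s' r (B w a) \<in> N)"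

lemma bilinear_modD:
  assumes "bilinear_mod s s' N B"
  shows "B (a + b) w - B a w - B b w \<in> N" "B (s r a) w - s' r (B a w) \<in> N"
    and "B w (a + b) - B w a - B w b \<in> N" "B w (s r a) - s' r (B w a) \<in> N"
  using assms by (simp_all add: bilinear_mod_def)

context vector_space
begin

text \<open>Universal property of the tensor square: the preimage of \<open>N\<close> under the
  linear extension is a subspace, and bilinearity modulo \<open>N\<close> puts every generator of
  \<open>null2 s\<close> into it.\<close>

lemma lin_ext_null2:
  assumes N: "subspace N" and B: "bilinear_mod s scale N B" and f: "f \<in> null2 s"
  shows "lin_ext scale (\<lambda>(u, v). B u v) f \<in> N"
proof -
  interpret L: Vector_Spaces.linear formal_scale scale "lin_ext scale (\<lambda>(u, v). B u v)"
    by (rule linear_lin_ext)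
  have "null2 s \<subseteq> lin_ext scale (\<lambda>(u, v). B u v) -` N"
    unfolding null2_def
    by (intro formal.span_minimal L.subspace_vimage N)
      (use B in \<open>auto simp: slot_relations_def bilinear_mod_def\<close>)
  then show ?thesis
    using f by auto
qed

lemma bilinear_mod_lin_ext:
  assumes "subspace N" "\<And>p. bilinear_mod s scale N (B p)"
  shows "bilinear_mod s scale N (\<lambda>u v. lin_ext scale (\<lambda>p. B p u v) f)"
  using assms unfolding bilinear_mod_def
  by (auto simp flip: lin_ext_fun_diff lin_ext_fun_scale intro!: lin_ext_mem)

end

section \<open>Cosets and pure tensors\<close>

lemma subspace_null2: "formal.subspace (null2 s)"
  by (simp add: null2_def)

lemma subspace_null3: "formal.subspace (null3 s)"
  by (simp add: null3_def)

lemma null2_zero: "0 \<in> null2 s" and null3_zero: "0 \<in> null3 s"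
  by (simp_all add: formal.subspace_0 subspace_null2 subspace_null3)

lemma tensor2_mem_iff: "f \<in> tensor2 s g \<longleftrightarrow> f - g \<in> null2 s"
  by (simp add: tensor2_def)

lemma tensor2_self: "f \<in> tensor2 s f"
  by (simp add: tensor2_mem_iff null2_zero)

lemma tensor2_eqI:
  assumes "f - g \<in> null2 s"
  shows "tensor2 s f = tensor2 s g"
proof -
  have "h - f \<in> null2 s \<longleftrightarrow> h - g \<in> null2 s" for h
    using formal.subspace_add[OF subspace_null2 _ assms, of "h - f"]
      formal.subspace_diff[OF subspace_null2 _ assms, of "h - g"] by auto
  then show ?thesis
    by (auto simp: tensor2_def)
qed

lemma tensor3_eqI:
  assumes "f - g \<in> null3 s"
  shows "tensor3 s f = tensor3 s g"
proof -
  have "h - f \<in> null3 s \<longleftrightarrow> h - g \<in> null3 s" for h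
    using formal.subspace_add[OF subspace_null3 _ assms, of "h - f"]
      formal.subspace_diff[OF subspace_null3 _ assms, of "h - g"] by auto
  then show ?thesis
    by (auto simp: tensor3_def)
qed

text \<open>The four bilinearity defects of a pure tensor are themselves elements of the slot
  relations.\<close>

lemma bilinear_mod_single:
  assumes "\<And>w. slot_relations s (\<lambda>u. \<iota> u w) \<subseteq> N" "\<And>w. slot_relations s (\<lambda>v. \<iota> w v) \<subseteq> N"
  shows "bilinear_mod s formal_scale N (\<lambda>u v. Poly_Mapping.single (\<iota> u v) 1)"
  unfolding bilinear_mod_def
  by (intro conjI allI subsetD[OF assms(1)] subsetD[OF assms(2)])
    (unfold slot_relations_def, blast+)

lemma bilinear_mod_pure2: "bilinear_mod s formal_scale (null2 s) pure2"
  by (rule bilinear_mod_single) (auto simp: null2_def intro: formal.span_base)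

lemma bilinear_mod_pure3:
  "bilinear_mod s formal_scale (null3 s) (\<lambda>u v. pure3 u v w)"
  "bilinear_mod s formal_scale (null3 s) (\<lambda>u v. pure3 u w v)"
  "bilinear_mod s formal_scale (null3 s) (\<lambda>u v. pure3 w u v)"
  by (rule bilinear_mod_single; auto simp: null3_def intro: formal.span_base)+

lemma pure2_zero_null2: "pure2 0 v \<in> null2 s" "pure2 v 0 \<in> null2 s" if "vector_space s"
proof -
  interpret vector_space s by fact
  show "pure2 0 v \<in> null2 s" "pure2 v 0 \<in> null2 s"
    \<comment> \<open>Homogeneity with factor 0: the subtracted term vanishes and only the pure
      tensor with a zero slot remains.\<close>
    using bilinear_modD(2,4)[OF bilinear_mod_pure2, where s = s and r = 0 and w = v] by simp_all
qed

lemma bilinear_mod_linear: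
  assumes "bilinear_mod s s' N B" "Vector_Spaces.linear s s F" "Vector_Spaces.linear s s G"
  shows "bilinear_mod s s' N (\<lambda>u v. B (F u) (G v))"
proof -
  interpret F: Vector_Spaces.linear s s F by fact
  interpret G: Vector_Spaces.linear s s G by fact
  show ?thesis
    using assms(1) by (simp add: bilinear_mod_def F.add F.scale G.add G.scale)
qed

section \<open>The coalgebra with basis 1, x, y, z, t\<close>

locale xyzt_coalgebra = pre_coalgebra scale \<Delta> \<epsilon>
  for scale :: "'k::field \<Rightarrow> 'v::ab_group_add \<Rightarrow> 'v" and \<Delta> \<epsilon> +
  fixes e x y z t :: 'v
  assumes distinct: "distinct [e, x, y, z, t]"
    and independent: "\<not> dependent {e, x, y, z, t}"
    and spanning: "span {e, x, y, z, t} = UNIV"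
    and group_like_e: "group_like scale \<Delta> \<epsilon> e"
    and primitive_t: "primitive scale \<Delta> e t"
    and primitive_y: "primitive scale \<Delta> e y"
    and primitive_z: "primitive scale \<Delta> e z"
    and comult_x: "\<Delta> x = tensor2 scale (pure2 e x + pure2 x e + pure2 y z)"
    and counit_basis [simp]: "\<epsilon> x = 0" "\<epsilon> y = 0" "\<epsilon> z = 0" "\<epsilon> t = 0"
begin

section \<open>Coordinates and equality of linear maps on the basis\<close>

sublocale counit: Vector_Spaces.linear scale "(*)" \<epsilon>
  by (rule counit_linear)

lemma counit_e [simp]: "\<epsilon> e = 1"
  using group_like_e by (simp add: group_like_def)

abbreviation coord :: "'v \<Rightarrow> 'v \<Rightarrow> 'k" where
  "coord b a \<equiv> representation {e, x, y, z, t} a b"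

lemma coord_add [simp]: "coord b (a + a') = coord b a + coord b a'"
  using independent spanning by (simp add: representation_add)

lemma coord_scale [simp]: "coord b (scale r a) = r * coord b a"
  using independent spanning by (simp add: representation_scale)

lemma coord_basis [simp]:
  "b \<in> {e, x, y, z, t} \<Longrightarrow> coord b' b = (if b' = b then 1 else 0)"
  using representation_basis[OF independent] by auto

lemma basis_distinct [simp]:
  "e \<noteq> x" "e \<noteq> y" "e \<noteq> z" "e \<noteq> t" "x \<noteq> y" "x \<noteq> z" "x \<noteq> t" "y \<noteq> z" "y \<noteq> t" "z \<noteq> t"
  "x \<noteq> e" "y \<noteq> e" "z \<noteq> e" "t \<noteq> e" "y \<noteq> x" "z \<noteq> x" "t \<noteq> x" "z \<noteq> y" "t \<noteq> y" "t \<noteq> z"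
  using distinct by auto

lemma basis_nonzero [simp]: "e \<noteq> 0" "x \<noteq> 0" "y \<noteq> 0" "z \<noteq> 0" "t \<noteq> 0"
  using independent dependent_zero[of "{e, x, y, z, t}"] by auto

lemma linear_eq_on_basis:
  assumes "Vector_Spaces.linear scale s F" "Vector_Spaces.linear scale s G"
    and "\<And>b. b \<in> {e, x, y, z, t} \<Longrightarrow> F b = G b"
  shows "F a = G a"
proof -
  interpret FG: vector_space_pair scale s
    using assms(1) unfolding Vector_Spaces.linear_def vector_space_pair_def by blast
  show ?thesis
    using FG.linear_eq_on[OF assms(1,2), of a "{e, x, y, z, t}"] assms(3) spanning by auto
qed

section \<open>A linear section of the comultiplication\<close>

definition section_at :: "'v \<Rightarrow> ('v \<times> 'v \<Rightarrow>\<^sub>0 'k)" where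
  "section_at a =
     formal_scale (coord e a) (pure2 e e)
   + formal_scale (coord x a) (pure2 e x + pure2 x e + pure2 y z)
   + formal_scale (coord y a) (pure2 e y + pure2 y e)
   + formal_scale (coord z a) (pure2 e z + pure2 z e)
   + formal_scale (coord t a) (pure2 e t + pure2 t e)"

lemma section_basis [simp]:
  "section_at e = pure2 e e"
  "section_at x = pure2 e x + pure2 x e + pure2 y z"
  "section_at y = pure2 e y + pure2 y e"
  "section_at z = pure2 e z + pure2 z e"
  "section_at t = pure2 e t + pure2 t e"
  by (simp_all add: section_at_def)

lemma section_add [simp]: "section_at (a + b) = section_at a + section_at b"
  by (simp add: section_at_def formal.scale_left_distrib)

lemma section_scale [simp]: "section_at (scale r a) = formal_scale r (section_at a)"
  by (simp add: section_at_def formal.scale_right_distrib)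

lemma linear_section: "Vector_Spaces.linear scale formal_scale section_at"
  by (intro_locales; unfold_locales) auto

lemma linear_lin_ext_section:
  "vector_space s \<Longrightarrow> Vector_Spaces.linear scale s (\<lambda>a. lin_ext s B (section_at a))"
  using Vector_Spaces.linear_compose[OF linear_section vector_space.linear_lin_ext]
  by (simp add: o_def)

lemma section_zero [simp]: "section_at 0 = 0"
  using section_scale[of 0 0] by simp

lemma section_mem: "section_at a \<in> \<Delta> a"
proof -
  have "a \<in> span {e, x, y, z, t}"
    using spanning by simp
  then show ?thesis
  proof (induction rule: span_induct_alt)
    case base
    \<comment> \<open>Linearity of \<open>\<Delta>\<close> is stated on representatives, so some
      representative of \<open>\<Delta> 0\<close> is scaled by 0 to see that the formal sum 0
      represents it too.\<close>
    obtain f where "f \<in> \<Delta> 0"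
      using comult_in_tensor[of 0] tensor2_self by (metis rangeE)
    from comult_scale[OF this, of 0] show ?case
      by (simp add: tensor2_self)
  next
    case (step r b a)
    have "section_at b \<in> \<Delta> b"
      using step(1) group_like_e primitive_t primitive_y primitive_z
      by (auto simp: comult_x group_like_def primitive_def tensor2_self)
    from comult_scale[OF this, of r] have "section_at (scale r b) \<in> \<Delta> (scale r b)"
      by (simp add: tensor2_self)
    from comult_add[OF this step(2)] show ?case
      by (simp add: tensor2_self)
  qed
qed

lemma comult_eq: "\<Delta> a = tensor2 scale (section_at a)"
  \<comment> \<open>Scaling by 1 turns the membership of the representative into a description of
    the whole coset.\<close>
  using comult_scale[OF section_mem, of 1 a] by simp

lemma comult_diff_null2: "f \<in> \<Delta> a \<Longrightarrow> f - section_at a \<in> null2 scale"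
  by (simp add: comult_eq tensor2_mem_iff)

text \<open>Sweedler notation does not depend on the representative: \<open>f\<close> and
  \<open>section_at a\<close> differ by an element of \<open>null2 scale\<close>, which a map
  bilinear modulo \<open>N\<close> sends into \<open>N\<close>.\<close>

lemma lin_ext_comult_mod:
  assumes "vector_space s" "module.subspace s N" "bilinear_mod scale s N B" "f \<in> \<Delta> a"
  shows "lin_ext s (\<lambda>(u, v). B u v) f - lin_ext s (\<lambda>(u, v). B u v) (section_at a) \<in> N"
proof -
  interpret s: vector_space s by fact
  show ?thesis
    using s.lin_ext_null2[OF assms(2,3) comult_diff_null2[OF assms(4)]] by simp
qed

lemma lin_ext_comult:
  assumes "bilinear_mod scale scale {0} B" "f \<in> \<Delta> a"
  shows "lin_ext scale (\<lambda>(u, v). B u v) f = lin_ext scale (\<lambda>(u, v). B u v) (section_at a)"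
  using lin_ext_comult_mod[OF vector_space_axioms _ assms] by simp

section \<open>Coassociativity and counit\<close>

lemma coalgebra: "coalgebra scale \<Delta> \<epsilon>"
proof (unfold_locales, goal_cases)
  case (1 f c d)
  let ?L = "\<lambda>d. lin_ext formal_scale (\<lambda>(c1, c2). lin_ext formal_scale (\<lambda>(p, q). pure3 p q c2) (d c1))"
  let ?R = "\<lambda>d. lin_ext formal_scale (\<lambda>(c1, c2). lin_ext formal_scale (\<lambda>(p, q). pure3 c1 p q) (d c2))"
  note trans = formal.subspace_diff_trans[OF subspace_null3]
  note N3 = formal.vector_space_axioms subspace_null3
  have d: "d a \<in> \<Delta> a" for a by (rule 1)
  \<comment> \<open>On each side the inner representatives \<open>d\<close> are replaced first and
    the outer representative \<open>f\<close> second, each time at the cost of an element of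
    \<open>null3 scale\<close>.\<close>
  have "?L d f - ?L section_at f \<in> null3 scale"
    by (rule formal.lin_ext_cong_mod[OF subspace_null3])
      (auto intro: lin_ext_comult_mod[OF N3 _ d] bilinear_mod_pure3)
  \<comment> \<open>Linearity in \<open>c1\<close> is exact because \<open>section_at\<close> is
    linear; linearity in \<open>c2\<close> holds modulo the relations of the third slot.\<close>
  moreover have "bilinear_mod scale formal_scale (null3 scale)
      (\<lambda>c1 c2. lin_ext formal_scale (\<lambda>(p, q). pure3 p q c2) (section_at c1))"
    unfolding bilinear_mod_def
    by (auto simp: null3_zero case_prod_beta
        simp flip: formal.lin_ext_fun_diff formal.lin_ext_fun_scale
        intro!: formal.lin_ext_mem[OF subspace_null3]
          bilinear_modD(3,4)[OF bilinear_mod_pure3(2)])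
  from lin_ext_comult_mod[OF N3 this 1(1)]
  have "?L section_at f - ?L section_at (section_at c) \<in> null3 scale" .
  ultimately have L: "?L d f - ?L section_at (section_at c) \<in> null3 scale"
    by (rule trans)
  have "?R d f - ?R section_at f \<in> null3 scale"
    by (rule formal.lin_ext_cong_mod[OF subspace_null3])
      (auto intro: lin_ext_comult_mod[OF N3 _ d] bilinear_mod_pure3)
  moreover have "bilinear_mod scale formal_scale (null3 scale)
      (\<lambda>c1 c2. lin_ext formal_scale (\<lambda>(p, q). pure3 c1 p q) (section_at c2))"
    unfolding bilinear_mod_def
    by (auto simp: null3_zero case_prod_beta
        simp flip: formal.lin_ext_fun_diff formal.lin_ext_fun_scale
        intro!: formal.lin_ext_mem[OF subspace_null3]
          bilinear_modD(1,2)[OF bilinear_mod_pure3(2)])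
  from lin_ext_comult_mod[OF N3 this 1(1)]
  have "?R section_at f - ?R section_at (section_at c) \<in> null3 scale" .
  ultimately have R: "?R d f - ?R section_at (section_at c) \<in> null3 scale"
    by (rule trans)
  \<comment> \<open>With these representatives coassociativity is an equality of formal sums, with
    no quotient left. For \<open>x\<close> both sides consist of the same six pure tensors.\<close>
  have "?L section_at (section_at c) = ?R section_at (section_at c)"
    by (rule linear_eq_on_basis[of formal_scale "\<lambda>c. ?L section_at (section_at c)"
          "\<lambda>c. ?R section_at (section_at c)"])
      (auto intro!: linear_lin_ext_section formal.vector_space_axioms)
  then have "?L d f - ?R d f \<in> null3 scale"
    using formal.subspace_diff[OF subspace_null3 L R] by simp
  then show ?case
    by (rule tensor3_eqI)
next
  case (2 f c)
  have "bilinear_mod scale scale {0} (\<lambda>u v. scale (\<epsilon> u) v)"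
    by (simp add: bilinear_mod_def counit.add counit.scale algebra_simps)
  moreover have "lin_ext scale (\<lambda>(u, v). scale (\<epsilon> u) v) (section_at c) = c"
    by (rule linear_eq_on_basis[OF linear_lin_ext_section linear_ident])
      (auto intro: vector_space_axioms)
  ultimately show ?case
    using lin_ext_comult[OF _ 2] by simp
next
  case (3 f c)
  have "bilinear_mod scale scale {0} (\<lambda>u v. scale (\<epsilon> v) u)"
    by (simp add: bilinear_mod_def counit.add counit.scale algebra_simps)
  moreover have "lin_ext scale (\<lambda>(u, v). scale (\<epsilon> v) u) (section_at c) = c"
    by (rule linear_eq_on_basis[OF linear_lin_ext_section linear_ident])
      (auto intro: vector_space_axioms)
  ultimately show ?case
    using lin_ext_comult[OF _ 3] by simp
qed

section \<open>The rack product\<close>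

definition yz_coord :: "'v \<Rightarrow> 'k" where
  "yz_coord b = coord y b + coord z b"

lemma yz_coord_add [simp]: "yz_coord (b + b') = yz_coord b + yz_coord b'"
  by (simp add: yz_coord_def)

lemma yz_coord_scale [simp]: "yz_coord (scale r b) = r * yz_coord b"
  by (simp add: yz_coord_def distrib_left)

lemma yz_coord_basis [simp]:
  "yz_coord e = 0" "yz_coord x = 0" "yz_coord y = 1" "yz_coord z = 1" "yz_coord t = 0"
  by (simp_all add: yz_coord_def)

definition rack :: "'v \<Rightarrow> 'v \<Rightarrow> 'v"  (infixl \<open>\<lhd>\<close> 70) where
  "a \<lhd> b = scale (\<epsilon> b) a + scale (yz_coord b * coord x a) t"

lemma rack_add [simp]:
  "(a + a') \<lhd> b = a \<lhd> b + a' \<lhd> b" "a \<lhd> (b + b') = a \<lhd> b + a \<lhd> b'"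
  by (simp_all add: rack_def counit.add scale_left_distrib scale_right_distrib distrib_left distrib_right)

lemma rack_scale [simp]:
  "scale r a \<lhd> b = scale r (a \<lhd> b)" "a \<lhd> scale r b = scale r (a \<lhd> b)"
  by (simp_all only: rack_def counit.scale coord_scale yz_coord_scale scale_right_distrib scale_scale
      mult.assoc mult.left_commute mult.commute[of r])

lemma linear_rack:
  "Vector_Spaces.linear scale scale (\<lambda>a. a \<lhd> b)" "Vector_Spaces.linear scale scale (\<lambda>b. a \<lhd> b)"
  by (simp_all add: Vector_Spaces.linear_iff vector_space_axioms)

text \<open>Discarding the tensors with a zero factor makes the compatibility of \<open>\<lhd>\<close> with the
  comultiplication an exact identity of formal sums on basis vectors.\<close>

definition reduced_pure2 :: "'v \<Rightarrow> 'v \<Rightarrow> ('v \<times> 'v \<Rightarrow>\<^sub>0 'k)" where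
  "reduced_pure2 u v = (if u = 0 \<or> v = 0 then 0 else pure2 u v)"

lemma reduced_pure2_mod: "pure2 u v - reduced_pure2 u v \<in> null2 scale"
  by (auto simp: reduced_pure2_def null2_zero pure2_zero_null2 vector_space_axioms)

text \<open>Although \<open>reduced_pure2\<close> is not bilinear, both sides are linear in
  \<open>a\<close> and in \<open>b\<close>, because these enter the left side only through the
  linear maps \<open>section_at\<close> and \<open>lin_ext\<close>. Hence pairs of basis vectors
  suffice: first \<open>b\<close> varies for a fixed basis vector \<open>a\<close>, then
  \<open>a\<close> is extended.\<close>

lemma section_rack:
  "lin_ext formal_scale (\<lambda>(a1, a2). lin_ext formal_scale
     (\<lambda>(b1, b2). reduced_pure2 (a1 \<lhd> b1) (a2 \<lhd> b2)) (section_at b)) (section_at a)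
   = section_at (a \<lhd> b)" (is "?K a b = _")
proof -
  have "?K a b = section_at (a \<lhd> b)" if a: "a \<in> {e, x, y, z, t}" for a
  proof (rule linear_eq_on_basis[of formal_scale "?K a" "\<lambda>b. section_at (a \<lhd> b)"])
    show "Vector_Spaces.linear scale formal_scale (?K a)"
      by (simp add: Vector_Spaces.linear_iff vector_space_axioms formal.vector_space_axioms
          case_prod_beta formal.lin_ext_fun_add formal.lin_ext_fun_scale)
    show "Vector_Spaces.linear scale formal_scale (\<lambda>b. section_at (a \<lhd> b))"
      by (simp add: Vector_Spaces.linear_iff vector_space_axioms formal.vector_space_axioms)
    show "?K a b = section_at (a \<lhd> b)" if "b \<in> {e, x, y, z, t}" for b
      using a that by (auto simp: rack_def reduced_pure2_def)
  qed
  then show ?thesis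
    by - (rule linear_eq_on_basis[of formal_scale "\<lambda>a. ?K a b" "\<lambda>a. section_at (a \<lhd> b)"],
      simp_all add: Vector_Spaces.linear_iff vector_space_axioms formal.vector_space_axioms)
qed

section \<open>The rack bialgebra axioms\<close>

lemma rack_bialgebra: "rack_bialgebra scale \<Delta> \<epsilon> e rack"
proof (rule rack_bialgebra.intro[OF coalgebra rack_bialgebra_axioms.intro], goal_cases)
  case 1
  show ?case by (rule group_like_e)
next
  case (2 b)
  show ?case by (rule linear_rack)
next
  case (3 a)
  show ?case by (rule linear_rack)
next
  case (4 f a g b)
  let ?I = "\<lambda>g a1 a2. lin_ext formal_scale (\<lambda>(b1, b2). pure2 (a1 \<lhd> b1) (a2 \<lhd> b2)) g"
  let ?K = "\<lambda>g f. lin_ext formal_scale (\<lambda>(a1, a2). ?I g a1 a2) f"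
  note N2 = formal.vector_space_axioms subspace_null2
  note trans = formal.subspace_diff_trans[OF subspace_null2]
  \<comment> \<open>Three changes by elements of \<open>null2 scale\<close> lead to
    \<open>section_at (a \<lhd> b)\<close>: \<open>g\<close> becomes \<open>section_at b\<close>,
    then \<open>f\<close> becomes \<open>section_at a\<close>, and finally \<open>pure2\<close>
    becomes \<open>reduced_pure2\<close>.\<close>
  have "?K g f - ?K (section_at b) f \<in> null2 scale"
    by (rule formal.lin_ext_cong_mod[OF subspace_null2])
      (auto intro!: lin_ext_comult_mod[OF N2 _ 4(2)] bilinear_mod_linear[OF bilinear_mod_pure2] linear_rack)
  moreover have "bilinear_mod scale formal_scale (null2 scale) (?I (section_at b))"
    unfolding case_prod_beta
    by (intro formal.bilinear_mod_lin_ext subspace_null2 bilinear_mod_linear[OF bilinear_mod_pure2] linear_rack)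
  from lin_ext_comult_mod[OF N2 this 4(1)]
  have "?K (section_at b) f - ?K (section_at b) (section_at a) \<in> null2 scale" .
  ultimately have "?K g f - ?K (section_at b) (section_at a) \<in> null2 scale"
    by (rule trans)
  moreover have "?K (section_at b) (section_at a) - section_at (a \<lhd> b) \<in> null2 scale"
    unfolding section_rack[symmetric]
    by (rule formal.lin_ext_cong_mod[OF subspace_null2])
      (auto intro!: formal.lin_ext_cong_mod[OF subspace_null2] reduced_pure2_mod)
  ultimately have "?K g f - section_at (a \<lhd> b) \<in> null2 scale"
    by (rule trans)
  then show ?case
    using tensor2_eqI comult_eq by metis
next
  case (5 a b)
  show ?case by (simp add: rack_def counit.add counit.scale)
next
  case (6 f c a b)
  have "bilinear_mod scale scale {0} (\<lambda>u v. (a \<lhd> u) \<lhd> (b \<lhd> v))"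
    by (simp add: bilinear_mod_def)
  \<comment> \<open>Since \<open>\<epsilon>\<close>, \<open>coord x\<close> and
    \<open>yz_coord\<close> all vanish on \<open>t\<close>, both sides equal
    \<open>\<epsilon> b\<close> times \<open>a \<lhd> c\<close> plus
    \<open>\<epsilon> c * yz_coord b * coord x a\<close> times \<open>t\<close>.\<close>
  moreover have "(a \<lhd> b) \<lhd> c = lin_ext scale (\<lambda>(u, v). (a \<lhd> u) \<lhd> (b \<lhd> v)) (section_at c)"
    by (rule linear_eq_on_basis[OF linear_rack(2) linear_lin_ext_section[OF vector_space_axioms]])
      (auto simp: rack_def counit.add counit.scale mult.commute)
  ultimately show ?case
    using lin_ext_comult[OF _ 6] by simp
next
  case (7 a)
  show ?case by (simp add: rack_def)
next
  case (8 a)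
  show ?case by (simp add: rack_def)
qed

section \<open>Uniqueness\<close>

lemma rack_unique:
  assumes "rack_bialgebra scale \<Delta> \<epsilon> e r"
    and "\<And>a. r a x = 0" "\<And>a. r a t = 0"
    and "r x z = t" "r x y = t" "r z z = 0" "r z y = 0"
    and "r y z = 0" "r y y = 0" "r t z = 0" "r t y = 0"
  shows "r = rack"
proof (intro ext)
  fix a b
  interpret R: rack_bialgebra scale \<Delta> \<epsilon> e r by fact
  show "r a b = a \<lhd> b"
  proof (rule linear_eq_on_basis[OF R.rack_linear_right linear_rack(2)])
    fix b assume b: "b \<in> {e, x, y, z, t}"
    show "r a b = a \<lhd> b"
    proof (rule linear_eq_on_basis[OF R.rack_linear_left linear_rack(1)])
      fix a assume "a \<in> {e, x, y, z, t}"
      then show "r a b = a \<lhd> b"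
        \<comment> \<open>The unit axioms settle the pairs containing \<open>e\<close>, the columns
          \<open>b = x\<close> and \<open>b = t\<close> vanish, and the eight pairs with
          \<open>a\<close> among \<open>x\<close>, \<open>y\<close>, \<open>z\<close>,
          \<open>t\<close> and \<open>b\<close> among \<open>y\<close>, \<open>z\<close> are the
          listed values.\<close>
        using b by (elim insertE emptyE; simp add: assms(2-) rack_def R.rack_unit_right R.rack_unit_left)
    qed
  qed
qed

end

theorem proposition4:
  fixes scale :: "'k::field \<Rightarrow> 'v::ab_group_add \<Rightarrow> 'v"
    and \<Delta> :: "'v \<Rightarrow> ('v \<times> 'v \<Rightarrow>\<^sub>0 'k) set"
    and \<epsilon> :: "'v \<Rightarrow> 'k"
    and e x y z t :: 'v
  assumes "pre_coalgebra scale \<Delta> \<epsilon>"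
    and "distinct [e, x, y, z, t]"
    and "\<not> module.dependent scale {e, x, y, z, t}"
    and "module.span scale {e, x, y, z, t} = UNIV"
    and "group_like scale \<Delta> \<epsilon> e"
    and "primitive scale \<Delta> e t" and "primitive scale \<Delta> e y" and "primitive scale \<Delta> e z"
    and "\<Delta> x = tensor2 scale (pure2 e x + pure2 x e + pure2 y z)"
    and "\<epsilon> x = 0" and "\<epsilon> y = 0" and "\<epsilon> z = 0" and "\<epsilon> t = 0"
  shows "\<exists>!rack :: 'v \<Rightarrow> 'v \<Rightarrow> 'v.
    rack_bialgebra scale \<Delta> \<epsilon> e rack
    \<and> (\<forall>a. rack a x = 0) \<and> (\<forall>a. rack a t = 0)
    \<and> rack x z = t \<and> rack x y = t \<and> rack z z = 0 \<and> rack z y = 0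
    \<and> rack y z = 0 \<and> rack y y = 0 \<and> rack t z = 0 \<and> rack t y = 0"
proof -
  interpret pre_coalgebra scale \<Delta> \<epsilon> by fact
  interpret xyzt_coalgebra scale \<Delta> \<epsilon> e x y z t
    using assms by unfold_locales auto
  show ?thesis
  proof (rule ex1I[of _ rack], goal_cases)
    case 1
    show ?case by (simp add: rack_bialgebra rack_def)
  next
    case (2 r)
    then show ?case by (intro rack_unique) simp_all
  qed
qed

end
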